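(* Let $q$ be an odd prime. The set of all non-zero periodic points of $T_q$ in $\mathbb{Z}$ is equal to $\mathbb{Z}\cap\chi_q\left(\mathbb{Q}\cap\mathbb{Z}_2^{\prime}\right)$, where $\chi_q(\mathbb{Q}\cap\mathbb{Z}_2^{\prime})$ is viewed as a subset of $\mathbb{Z}_q$. Equivalently: an integer $x\neq 0$ is a periodic point of $T_q$ if and only if there is $\mathfrak{z}\in\mathbb{Q}\cap\mathbb{Z}_2^{\prime}$ with $\chi_q(\mathfrak{z})=x$, and $0\notin\chi_q(\mathbb{Q}\cap\mathbb{Z}_2^{\prime})$.
   Context: $\mathbb{N}_0=\{0,1,2,\ldots\}$ and $\mathbb{Z}_2^{\prime}=\mathbb{Z}_2\setminus\mathbb{N}_0$. For an odd prime $q$, the map $T_q:\mathbb{Z}\to\mathbb{Z}$ is $T_q(n)=n/2$ if $n$ is even and $T_q(n)=(qn+1)/2$ if $n$ is odd. An integer $x$ is a periodic point of $T_q$ if $T_q^{\circ k}(x)=x$ for some $k\geq 1$. Definition of $\chi_q$. Let $H_0(x)=x/2$ and $H_1(x)=(qx+1)/2$. For a finite string $\mathbf{j}=(j_1,\ldots,j_m)$ of $0$s and $1$s put $H_{\mathbf{j}}=H_{j_1}\circ\cdots\circ H_{j_m}$ (the identity for the empty string). For $n\in\mathbb{N}_0$ set $\chi_q(n)=H_{\mathbf{j}}(0)\in\mathbb{Q}$, where $\mathbf{j}$ is any string with $n=\sum_{k=1}^{m}j_k2^{k-1}$ (the value does not depend on the choice of $\mathbf{j}$). For $\mathfrak{z}\in\mathbb{Z}_2$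 let $[\mathfrak{z}]_{2^n}$ be the unique integer in $\{0,\ldots,2^n-1\}$ congruent to $\mathfrak{z}$ mod $2^n$; then $\chi_q:\mathbb{Z}_2\to\mathbb{Z}_q$ is defined by $\chi_q(\mathfrak{z})=\lim_{n\to\infty}\chi_q([\mathfrak{z}]_{2^n})$, the limit being taken in $\mathbb{Z}_q$ (it always exists). *)

theory Defs
  imports "HOL-Analysis.Function_Topology" "HOL-Algebra.Ring" "HOL-Number_Theory.Cong"
begin

section \<open>The ring of $p$-adic integers\<close>

text \<open>
  The ring \<open>\<int>\<^sub>p\<close> is the inverse limit of the rings \<open>\<int>/p\<^sup>n\<close>: an element is a coherent
  sequence \<open>z\<close>, where \<open>z n\<close> in \<open>{0..<p\<^sup>n}\<close> represents the residue of \<open>z\<close> modulo \<open>p\<^sup>n\<close>.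
  In particular \<open>z n\<close> is the integer usually written $[z]_{p^n}$.
\<close>

definition padic_int_ring :: "nat \<Rightarrow> (nat \<Rightarrow> int) ring" where
  "padic_int_ring p =
    \<lparr>carrier = {z. \<forall>n. z n \<in> {0..<int p ^ n} \<and> z (Suc n) mod int p ^ n = z n},
     monoid.mult = (\<lambda>x y n. (x n * y n) mod int p ^ n),
     one = (\<lambda>n. 1 mod int p ^ n),
     zero = (\<lambda>n. 0),
     add = (\<lambda>x y n. (x n + y n) mod int p ^ n)\<rparr>"

definition padic_of_int :: "nat \<Rightarrow> int \<Rightarrow> nat \<Rightarrow> int" where
  "padic_of_int p a = (\<lambda>n. a mod int p ^ n)"

text \<open>The elements of \<open>\<rat> \<inter> \<int>\<^sub>p\<close>, the intersection being taken in the fraction field of \<open>\<int>\<^sub>p\<close>.\<close>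

definition padic_rationals :: "nat \<Rightarrow> (nat \<Rightarrow> int) set" where
  "padic_rationals p = {z \<in> carrier (padic_int_ring p).
     \<exists>a b. b \<noteq> 0 \<and> padic_of_int p b \<otimes>\<^bsub>padic_int_ring p\<^esub> z = padic_of_int p a}"

text \<open>
  The image in \<open>\<int>\<^sub>p\<close> of a rational number; meaningful only if \<open>p\<close> does not divide its denominator.
\<close>

definition padic_of_rat :: "nat \<Rightarrow> rat \<Rightarrow> nat \<Rightarrow> int" where
  "padic_of_rat p r = (THE z. z \<in> carrier (padic_int_ring p) \<and>
     padic_of_int p (snd (quotient_of r)) \<otimes>\<^bsub>padic_int_ring p\<^esub> z = padic_of_int p (fst (quotient_of r)))"

definition Z2' :: "(nat \<Rightarrow> int) set" where
  "Z2' = carrier (padic_int_ring 2) - range (\<lambda>n::nat. padic_of_int 2 (int n))"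


section \<open>The map $T_q$\<close>

definition T_map :: "nat \<Rightarrow> int \<Rightarrow> int" where
  "T_map q n = (if even n then n div 2 else (int q * n + 1) div 2)"

definition periodic_point :: "nat \<Rightarrow> int \<Rightarrow> bool" where
  "periodic_point q x \<longleftrightarrow> (\<exists>k\<ge>1. (T_map q ^^ k) x = x)"


section \<open>The map $\chi_q$\<close>

definition H_branch :: "nat \<Rightarrow> bool \<Rightarrow> rat \<Rightarrow> rat" where
  "H_branch q j x = (if j then (of_nat q * x + 1) / 2 else x / 2)"

definition H_string :: "nat \<Rightarrow> bool list \<Rightarrow> rat \<Rightarrow> rat" where
  "H_string q js = foldr (H_branch q) js"

text \<open>
  The term \<open>horner_sum of_bool 2 js\<close> is the number whose binary digits, least significant first,
  are \<open>js\<close>; trailing zeros are allowed.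
\<close>

definition chi_nat :: "nat \<Rightarrow> nat \<Rightarrow> rat" where
  "chi_nat q n = (THE r. \<exists>js. horner_sum of_bool 2 js = n \<and> r = H_string q js 0)"

text \<open>
  The limit below is taken in the product topology on \<^typ>\<open>nat \<Rightarrow> int\<close> with discrete factors,
  which induces the $q$-adic topology on \<open>\<int>\<^sub>q\<close>.
\<close>

definition chi :: "nat \<Rightarrow> (nat \<Rightarrow> int) \<Rightarrow> nat \<Rightarrow> int" where
  "chi q z = (THE x. x \<in> carrier (padic_int_ring q) \<and>
     (\<lambda>n. padic_of_rat q (chi_nat q (nat (z n)))) \<longlonglongrightarrow> x)"


section \<open>Well-definedness\<close>

lemma cring_padic_int_ring:
  assumes "p > 0"
  shows "cring (padic_int_ring p)"
proof -
  have pos: "int p ^ n > 0" for n using assms by simp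
  have co: "(u mod int p ^ Suc n) mod int p ^ n = u mod int p ^ n" for u n
    by (rule mod_mod_cancel) simp
  have carrier_iff: "x \<in> carrier (padic_int_ring p) \<longleftrightarrow>
      (\<forall>n. 0 \<le> x n) \<and> (\<forall>n. x n < int p ^ n) \<and> (\<forall>n. x (Suc n) mod int p ^ n = x n)" for x
    by (auto simp: padic_int_ring_def)
  have cong_mult: "(x (Suc n) * y (Suc n)) mod int p ^ n = (x n * y n) mod int p ^ n"
    if "x \<in> carrier (padic_int_ring p)" "y \<in> carrier (padic_int_ring p)" for x y n
    using that by (metis carrier_iff mod_mult_eq)
  have cong_add: "(x (Suc n) + y (Suc n)) mod int p ^ n = (x n + y n) mod int p ^ n"
    if "x \<in> carrier (padic_int_ring p)" "y \<in> carrier (padic_int_ring p)" for x y n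
    using that by (metis carrier_iff mod_add_eq)
  have mod_carrier: "(\<lambda>n. u n mod int p ^ n) \<in> carrier (padic_int_ring p)"
    if "\<And>n. u (Suc n) mod int p ^ n = u n mod int p ^ n" for u
    unfolding carrier_iff co that using pos by simp
  have red: "x n mod int p ^ n = x n" if "x \<in> carrier (padic_int_ring p)" for x n
    using that by (auto simp: padic_int_ring_def)
  have neg: "\<exists>y \<in> carrier (padic_int_ring p). y \<oplus>\<^bsub>padic_int_ring p\<^esub> x = \<zero>\<^bsub>padic_int_ring p\<^esub>"
    if x: "x \<in> carrier (padic_int_ring p)" for x
  proof (rule bexI[of _ "\<lambda>n. (- x n) mod int p ^ n"])
    show "(\<lambda>n. (- x n) mod int p ^ n) \<oplus>\<^bsub>padic_int_ring p\<^esub> x = \<zero>\<^bsub>padic_int_ring p\<^esub>"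
      by (auto simp: padic_int_ring_def fun_eq_iff mod_simps)
    have "(- x (Suc n)) mod int p ^ n = (- x n) mod int p ^ n" for n
      using x by (metis carrier_iff mod_minus_eq)
    then show "(\<lambda>n. (- x n) mod int p ^ n) \<in> carrier (padic_int_ring p)"
      by (rule mod_carrier)
  qed
  have assoc_add: "((u + v) mod m + w) mod m = (u + (v + w) mod m) mod m" for u v w m :: int
    by (simp add: mod_simps add.assoc)
  have assoc_mult: "((u * v) mod m * w) mod m = (u * ((v * w) mod m)) mod m" for u v w m :: int
    by (simp add: mod_simps mult.assoc)
  have distrib: "((u + v) mod m * w) mod m = ((u * w) mod m + (v * w) mod m) mod m" for u v w m :: int
    by (simp add: mod_simps distrib_right)
  show ?thesis
  proof (rule cringI)
    show "abelian_group (padic_int_ring p)"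
    proof (rule abelian_groupI)
      fix x y assume "x \<in> carrier (padic_int_ring p)" "y \<in> carrier (padic_int_ring p)"
      then show "x \<oplus>\<^bsub>padic_int_ring p\<^esub> y \<in> carrier (padic_int_ring p)"
        using mod_carrier[of "\<lambda>n. x n + y n"] cong_add[of x y] by (simp add: padic_int_ring_def)
    next
      show "\<zero>\<^bsub>padic_int_ring p\<^esub> \<in> carrier (padic_int_ring p)"
        using mod_carrier[of "\<lambda>_. 0"] by (simp add: padic_int_ring_def)
    next
      fix x assume "x \<in> carrier (padic_int_ring p)"
      then show "\<zero>\<^bsub>padic_int_ring p\<^esub> \<oplus>\<^bsub>padic_int_ring p\<^esub> x = x"
        using red by (auto simp: padic_int_ring_def fun_eq_iff)
    next
      fix x y z
      show "x \<oplus>\<^bsub>padic_int_ring p\<^esub> y \<oplus>\<^bsub>padic_int_ring p\<^esub> z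
          = x \<oplus>\<^bsub>padic_int_ring p\<^esub> (y \<oplus>\<^bsub>padic_int_ring p\<^esub> z)"
        by (simp add: padic_int_ring_def assoc_add)
      show "x \<oplus>\<^bsub>padic_int_ring p\<^esub> y = y \<oplus>\<^bsub>padic_int_ring p\<^esub> x"
        by (simp add: padic_int_ring_def add.commute)
    qed (rule neg)
    show "Group.comm_monoid (padic_int_ring p)"
    proof (rule comm_monoidI)
      fix x y assume "x \<in> carrier (padic_int_ring p)" "y \<in> carrier (padic_int_ring p)"
      then show "x \<otimes>\<^bsub>padic_int_ring p\<^esub> y \<in> carrier (padic_int_ring p)"
        using mod_carrier[of "\<lambda>n. x n * y n"] cong_mult[of x y] by (simp add: padic_int_ring_def)
    next
      show "\<one>\<^bsub>padic_int_ring p\<^esub> \<in> carrier (padic_int_ring p)"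
        using mod_carrier[of "\<lambda>_. 1"] by (simp add: padic_int_ring_def)
    next
      fix x assume "x \<in> carrier (padic_int_ring p)"
      then show "\<one>\<^bsub>padic_int_ring p\<^esub> \<otimes>\<^bsub>padic_int_ring p\<^esub> x = x"
        using red by (auto simp: padic_int_ring_def fun_eq_iff mod_mult_left_eq)
    next
      fix x y z
      show "x \<otimes>\<^bsub>padic_int_ring p\<^esub> y \<otimes>\<^bsub>padic_int_ring p\<^esub> z
          = x \<otimes>\<^bsub>padic_int_ring p\<^esub> (y \<otimes>\<^bsub>padic_int_ring p\<^esub> z)"
        by (simp add: padic_int_ring_def assoc_mult)
      show "x \<otimes>\<^bsub>padic_int_ring p\<^esub> y = y \<otimes>\<^bsub>padic_int_ring p\<^esub> x"
        by (simp add: padic_int_ring_def mult.commute)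
    qed
    fix x y z
    show "(x \<oplus>\<^bsub>padic_int_ring p\<^esub> y) \<otimes>\<^bsub>padic_int_ring p\<^esub> z
        = x \<otimes>\<^bsub>padic_int_ring p\<^esub> z \<oplus>\<^bsub>padic_int_ring p\<^esub> y \<otimes>\<^bsub>padic_int_ring p\<^esub> z"
      by (simp add: padic_int_ring_def distrib)
  qed
qed

lemma padic_of_rat:
  assumes "coprime (snd (quotient_of r)) (int p)" and "p > 0"
  shows "padic_of_rat p r \<in> carrier (padic_int_ring p)"
    and "padic_of_int p (snd (quotient_of r)) \<otimes>\<^bsub>padic_int_ring p\<^esub> padic_of_rat p r
           = padic_of_int p (fst (quotient_of r))"
proof -
  define a b where "a = fst (quotient_of r)" and "b = snd (quotient_of r)"
  have cop: "coprime b (int p ^ n)" for n using assms by (simp add: b_def)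
  have pos: "int p ^ n > 0" for n using assms by simp
  have "\<exists>u. [b * u = a] (mod int p ^ n)" for n
  proof -
    obtain v where "[b * v = 1] (mod int p ^ n)"
      using cong_solve_coprime_int[OF cop] by blast
    then have "[b * v * a = 1 * a] (mod int p ^ n)"
      by (rule cong_scalar_right)
    then show ?thesis by (auto simp: mult.assoc)
  qed
  then obtain u where u: "\<And>n. [b * u n = a] (mod int p ^ n)" by metis
  define z where "z = (\<lambda>n. u n mod int p ^ n)"
  have bz: "[b * z n = a] (mod int p ^ n)" for n
    using u[of n] by (simp add: z_def cong_def mod_simps)
  have "z (Suc n) mod int p ^ n = z n" for n
  proof -
    have "[b * z (Suc n) = a] (mod int p ^ n)"
      using bz[of "Suc n"] by (rule cong_dvd_modulus) simp
    then have "[b * z (Suc n) = b * z n] (mod int p ^ n)"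
      using bz cong_sym cong_trans by blast
    then have "[z (Suc n) = z n] (mod int p ^ n)"
      using cop cong_mult_lcancel by blast
    then show ?thesis by (simp add: cong_def z_def)
  qed
  then have z: "z \<in> carrier (padic_int_ring p)"
    using pos by (auto simp: padic_int_ring_def z_def)
  have iff: "(padic_of_int p b \<otimes>\<^bsub>padic_int_ring p\<^esub> y = padic_of_int p a)
      \<longleftrightarrow> (\<forall>n. [b * y n = a] (mod int p ^ n))" for y
    by (simp add: padic_int_ring_def padic_of_int_def fun_eq_iff cong_def mod_simps)
  have uniq: "y = z" if "y \<in> carrier (padic_int_ring p)" "\<forall>n. [b * y n = a] (mod int p ^ n)" for y
  proof
    fix n
    have "[b * y n = b * z n] (mod int p ^ n)"
      using bz that cong_sym cong_trans by blast
    then have "[y n = z n] (mod int p ^ n)"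
      using cop cong_mult_lcancel by blast
    then show "y n = z n"
      using that z by (auto simp: padic_int_ring_def cong_def)
  qed
  have "padic_of_rat p r = z"
    unfolding padic_of_rat_def a_def[symmetric] b_def[symmetric] iff
    by (rule the_equality) (use z bz in blast, use uniq in blast)
  then show "padic_of_rat p r \<in> carrier (padic_int_ring p)"
    and "padic_of_int p (snd (quotient_of r)) \<otimes>\<^bsub>padic_int_ring p\<^esub> padic_of_rat p r
           = padic_of_int p (fst (quotient_of r))"
    using z bz iff by (auto simp: a_def[symmetric] b_def[symmetric])
qed

lemma H_string_zeros: "horner_sum of_bool (2::nat) js = 0 \<Longrightarrow> H_string q js 0 = 0"
  by (induction js) (auto simp: H_string_def H_branch_def split: if_splits)

lemma H_string_digits:
  "horner_sum of_bool (2::nat) js = horner_sum of_bool 2 ks \<Longrightarrow> H_string q js 0 = H_string q ks 0"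
proof (induction js arbitrary: ks)
  case Nil
  then show ?case using H_string_zeros[of ks q] by (simp add: H_string_def)
next
  case (Cons j js)
  show ?case
  proof (cases ks)
    case Nil
    then show ?thesis using Cons.prems H_string_zeros[of "j # js" q] by (simp add: H_string_def)
  next
    case (Cons k ks')
    have eq: "of_bool j + 2 * horner_sum of_bool (2::nat) js = of_bool k + 2 * horner_sum of_bool 2 ks'"
      using Cons.prems Cons by simp
    then have "j = k" and "horner_sum of_bool (2::nat) js = horner_sum of_bool 2 ks'"
      by (cases j; cases k; simp; presburger)+
    then show ?thesis using Cons.IH[of ks'] Cons by (simp add: H_string_def)
  qed
qed

lemma chi_nat_horner_sum: "chi_nat q (horner_sum of_bool 2 js) = H_string q js 0"
  unfolding chi_nat_def by (rule the_equality) (use H_string_digits in blast)+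

lemma coprime_denominator:
  assumes "r = of_int a / of_int d" "d \<noteq> 0" "coprime d c"
  shows "coprime (snd (quotient_of r)) c"
proof -
  define x y where "x = fst (quotient_of r)" and "y = snd (quotient_of r)"
  have xy: "quotient_of r = (x, y)" by (simp add: x_def y_def)
  have "y > 0" using quotient_of_denom_pos[OF xy] .
  have "of_int x / of_int y = (of_int a / of_int d :: rat)"
    using quotient_of_div[OF xy] assms(1) by metis
  then have "(of_int a * of_int y :: rat) = of_int x * of_int d"
    using \<open>y > 0\<close> assms(2) by (simp add: frac_eq_eq)
  then have "a * y = x * d" by (metis of_int_eq_iff of_int_mult)
  then have "y dvd d * x" by (metis dvd_triv_right mult.commute)
  then have "y dvd d"
    using quotient_of_coprime[OF xy] by (simp add: coprime_commute coprime_dvd_mult_left_iff)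
  then show ?thesis using coprime_divisors[OF _ dvd_refl assms(3)] by (simp add: y_def)
qed

lemma padic_of_rat_cong:
  assumes cop: "coprime (snd (quotient_of r)) (int p)" "coprime (snd (quotient_of s)) (int p)"
    and "p > 0" "d \<noteq> 0" "coprime d (int p)" and rs: "r - s = of_int (int p ^ m * c) / of_int d"
  shows "padic_of_rat p r m = padic_of_rat p s m"
proof -
  define x y where "x = fst (quotient_of r)" and "y = snd (quotient_of r)"
  define u v where "u = fst (quotient_of s)" and "v = snd (quotient_of s)"
  have xy: "quotient_of r = (x, y)" by (simp add: x_def y_def)
  have uv: "quotient_of s = (u, v)" by (simp add: u_def v_def)
  have pos: "y > 0" "v > 0" using quotient_of_denom_pos xy uv by auto
  have "of_int ((x * v - u * y) * d) = (of_int (int p ^ m * c * y * v) :: rat)"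
    using rs pos \<open>d \<noteq> 0\<close> unfolding quotient_of_div[OF xy] quotient_of_div[OF uv]
    by (simp add: field_simps)
  then have "(x * v - u * y) * d = int p ^ m * c * y * v" by (simp only: of_int_eq_iff)
  then have "int p ^ m dvd (x * v - u * y) * d" by (simp add: mult.assoc)
  then have "int p ^ m dvd x * v - u * y"
    using assms(5) by (simp add: coprime_commute coprime_dvd_mult_left_iff)
  then have 1: "[x * v = u * y] (mod int p ^ m)" by (simp add: cong_iff_dvd_diff)
  have eq: "[snd (quotient_of t) * padic_of_rat p t m = fst (quotient_of t)] (mod int p ^ m)"
    if "coprime (snd (quotient_of t)) (int p)" for t
    using fun_cong[OF padic_of_rat(2)[OF that \<open>p > 0\<close>], of m]
    by (simp add: padic_int_ring_def padic_of_int_def cong_def mod_mult_left_eq)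
  have "[(y * padic_of_rat p r m) * v = x * v] (mod int p ^ m)"
    using eq[OF cop(1)] unfolding x_def y_def by (rule cong_scalar_right)
  moreover have "[(v * padic_of_rat p s m) * y = u * y] (mod int p ^ m)"
    using eq[OF cop(2)] unfolding u_def v_def by (rule cong_scalar_right)
  ultimately have "[(y * padic_of_rat p r m) * v = (v * padic_of_rat p s m) * y] (mod int p ^ m)"
    using 1 cong_sym cong_trans by blast
  then have "[(y * v) * padic_of_rat p r m = (y * v) * padic_of_rat p s m] (mod int p ^ m)"
    by (simp add: ac_simps)
  moreover have "coprime (y * v) (int p ^ m)" using cop by (simp add: y_def v_def)
  ultimately have "[padic_of_rat p r m = padic_of_rat p s m] (mod int p ^ m)"
    using cong_mult_lcancel by blast
  then show ?thesis
    using padic_of_rat(1)[OF cop(1) \<open>p > 0\<close>] padic_of_rat(1)[OF cop(2) \<open>p > 0\<close>]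
    by (auto simp: padic_int_ring_def cong_def)
qed

lemma H_string_affine:
  "H_string q js y = H_string q js 0 + of_nat q ^ count_list js True / 2 ^ length js * y"
  by (induction js) (auto simp: H_string_def H_branch_def field_simps)

lemma H_string_dyadic: "\<exists>a. H_string q js 0 = of_int a / of_int (2 ^ length js)"
proof (induction js)
  case (Cons j js)
  then obtain a where a: "H_string q js 0 = of_int a / of_int (2 ^ length js)" by blast
  then have "H_string q (j # js) 0
      = of_int (if j then int q * a + 2 ^ length js else a) / of_int (2 ^ length (j # js))"
    by (auto simp: H_string_def H_branch_def field_simps)
  then show ?case by blast
qed (auto simp: H_string_def intro: exI[of _ 0])

text \<open>The defining limit of \<open>chi\<close> exists in \<open>\<int>\<^sub>q\<close>.\<close>

lemma chi_limit:
  assumes q: "odd q" and z: "z \<in> carrier (padic_int_ring 2)"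
  shows "chi q z \<in> carrier (padic_int_ring q)"
    and "(\<lambda>n. padic_of_rat q (chi_nat q (nat (z n)))) \<longlonglongrightarrow> chi q z"
proof -
  define w where "w n = nat (z n)" for n
  define ds where "ds n = map (\<lambda>k. bit (w (Suc k)) k) [0..<n]" for n
  define c where "c n = count_list (ds n) True" for n
  define s where "s n = padic_of_rat q (chi_nat q (w n))" for n
  have "q > 0" using q by (cases q) auto
  have cop2: "coprime (2 ^ k) (int q)" for k using q by simp
  have z': "0 \<le> z n" "z n < 2 ^ n" "z (Suc n) mod 2 ^ n = z n" for n
    using z by (auto simp: padic_int_ring_def)
  have w_mod: "take_bit n (w (Suc n)) = w n" for n
    using z'(1)[of "Suc n"] z'(3)[of n] by (simp add: w_def take_bit_eq_mod nat_mod_as_int)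
  have w_less: "take_bit n (w n) = w n" for n
    using z'[of n] by (simp add: w_def take_bit_nat_eq_self_iff nat_less_iff)
  have ds_Suc: "ds (Suc n) = ds n @ [bit (w (Suc n)) n]" for n by (simp add: ds_def)
  have len: "length (ds n) = n" for n by (simp add: ds_def)
  have horner: "horner_sum of_bool 2 (ds n) = w n" for n
  proof (induction n)
    case 0
    then show ?case using w_less[of 0] by (simp add: ds_def)
  next
    case (Suc n)
    then show ?case
      using w_less[of "Suc n"] w_mod[of n]
      by (simp add: ds_Suc len horner_sum_append take_bit_Suc_from_most)
  qed
  have chi_w: "chi_nat q (w n) = H_string q (ds n) 0" for n
    using chi_nat_horner_sum[of q "ds n"] horner by simp
  have cop: "coprime (snd (quotient_of (chi_nat q (w n)))) (int q)" for n
  proof -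
    obtain a where "chi_nat q (w n) = of_int a / of_int (2 ^ n)"
      using H_string_dyadic[of q "ds n"] chi_w len by auto
    then show ?thesis by (rule coprime_denominator[OF _ _ cop2]) simp
  qed
  have s_carrier: "s n \<in> carrier (padic_int_ring q)" for n
    unfolding s_def using padic_of_rat(1)[OF cop \<open>q > 0\<close>] .
  have c_Suc: "c (Suc n) = c n + of_bool (bit (w (Suc n)) n)" for n
    by (simp add: c_def ds_Suc)
  have s_step: "s (Suc n) m = s n m" if "\<not> bit (w (Suc n)) n \<or> m \<le> c n" for m n
  proof (cases "bit (w (Suc n)) n")
    case False
    then show ?thesis
      unfolding s_def chi_w ds_Suc by (simp add: H_string_def H_branch_def)
  next
    case True
    then have "m \<le> c n" using that by simp
    then obtain e where e: "c n = m + e" using le_Suc_ex by blast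
    have "chi_nat q (w (Suc n)) = H_string q (ds n) (1 / 2)"
      unfolding chi_w ds_Suc using True by (simp add: H_string_def H_branch_def)
    also have "\<dots> = chi_nat q (w n) + of_nat q ^ c n / 2 ^ n * (1 / 2)"
      unfolding chi_w c_def using H_string_affine[of q "ds n" "1 / 2"] len by metis
    finally have "chi_nat q (w (Suc n)) - chi_nat q (w n)
        = of_int (int q ^ m * int q ^ e) / of_int (2 ^ Suc n)"
      by (simp add: e power_add)
    from padic_of_rat_cong[OF cop cop \<open>q > 0\<close> _ cop2 this]
    show ?thesis by (simp add: s_def)
  qed
  have stable: "\<exists>N. \<forall>n\<ge>N. s n m = s N m" for m
  proof -
    obtain N where N: "\<And>n. min (c n) m \<le> min (c N) m"
      using ex_has_greatest_nat[of "\<lambda>_. True" 0 "\<lambda>n. min (c n) m" "Suc m"]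
      by (auto simp: less_Suc_eq_le)
    have mono: "c n \<ge> c N" if "n \<ge> N" for n
      using that by (induction n rule: dec_induct) (auto simp: c_Suc)
    have step: "s (Suc n) m = s n m" if "n \<ge> N" for n
      by (rule s_step) (use mono[OF that] N[of "Suc n"] c_Suc[of n] in auto)
    have "s n m = s N m" if "n \<ge> N" for n
      using that by (induction n rule: dec_induct) (simp_all add: step)
    then show ?thesis by blast
  qed
  then obtain N where N: "\<And>m n. n \<ge> N m \<Longrightarrow> s n m = s (N m) m" by metis
  define x where "x m = s (N m) m" for m
  have s_x: "s n m = x m" if "n \<ge> N m" for m n unfolding x_def using that by (rule N)
  have lim_iff: "s \<longlonglongrightarrow> y \<longleftrightarrow> y = x" for y
  proof -
    have "s \<longlonglongrightarrow> y \<longleftrightarrow> (\<forall>m. (\<lambda>n. s n m) \<longlonglongrightarrow> y m)"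
      using limitin_componentwise[of "\<lambda>_. euclidean" UNIV s y sequentially]
      by (simp add: euclidean_product_topology)
    also have "\<dots> \<longleftrightarrow> (\<forall>m. y m = x m)"
    proof -
      have "(\<lambda>n. s n m) \<longlonglongrightarrow> x m" for m
        by (rule tendsto_eventually) (use s_x in \<open>auto simp: eventually_sequentially\<close>)
      then show ?thesis using LIMSEQ_unique by (metis (no_types, lifting) ext)
    qed
    finally show ?thesis by (simp add: fun_eq_iff)
  qed
  have x_carrier: "x \<in> carrier (padic_int_ring q)"
  proof -
    have "x m \<in> {0..<int q ^ m} \<and> x (Suc m) mod int q ^ m = x m" for m
    proof -
      define n where "n = max (N m) (N (Suc m))"
      have "x m = s n m" "x (Suc m) = s n (Suc m)"
        using s_x[of m n] s_x[of "Suc m" n] by (auto simp: n_def)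
      then show ?thesis using s_carrier[of n] by (auto simp: padic_int_ring_def)
    qed
    then show ?thesis by (simp add: padic_int_ring_def)
  qed
  have "chi q z = x"
    unfolding chi_def w_def[symmetric] s_def[symmetric] lim_iff using x_carrier by auto
  then show "chi q z \<in> carrier (padic_int_ring q)"
    and "(\<lambda>n. padic_of_rat q (chi_nat q (nat (z n)))) \<longlonglongrightarrow> chi q z"
    using x_carrier lim_iff by (auto simp: w_def[symmetric] s_def[symmetric])
qed

end

theory Submission
  imports Defs
begin

text \<open>
  Let $d_0, d_1, \dots$ be the binary digits of \<open>z\<close>, infinitely many of which are 1. An integer \<open>x\<close>
  equals $\chi_q(z)$ if and only if there are integers $Y_0 = x, Y_1, Y_2, \dots$ with
  $Y_n = H_{d_n}(Y_{n+1})$: truncating the digits at \<open>n\<close> gives $2^n x = A_n + q^{c_n} Y_n$, where $A_n = 2^n \chi_q([z]_{2^n})$ and $c_n$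
  counts the ones among the first \<open>n\<close> digits, and $c_n \to \infty$. As \<open>q\<close> is odd, $H_{d_n}$ maps $Y_{n+1}$ to an
  integer only if $d_n$ is the parity of $Y_{n+1}$, so $T_q(Y_{n+1}) = Y_n$ and \<open>Y\<close> is a backward
  orbit of \<open>x\<close>. If \<open>z\<close> is rational, its digits are eventually periodic; since digits determine
  backward orbits, $Y_l = Y_{l+k}$ for some \<open>l\<close> and \<open>k \<ge> 1\<close>, and applying $T_q^l$ shows that \<open>x\<close> is periodic.
  Conversely, following the cycle of a periodic point backwards yields a periodic digit sequence.
\<close>

section \<open>Binary digits, numerators and backward orbits\<close>

text \<open>Coherence leaves only \<open>z n\<close> and \<open>z n + 2 ^ n\<close> as values of
  \<open>z (Suc n)\<close>, so a binary digit 1 shows as a change of residue.\<close>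

definition digit :: "(nat \<Rightarrow> int) \<Rightarrow> nat \<Rightarrow> bool" where
  "digit z n \<longleftrightarrow> z (Suc n) \<noteq> z n"

definition ones :: "(nat \<Rightarrow> bool) \<Rightarrow> nat \<Rightarrow> nat" where
  "ones d n = (\<Sum>i<n. of_bool (d i))"

text \<open>This is the integer $A_n$. A new digit 1 enters as the innermost branch and replaces the
  argument 0 by 1/2; by affinity this adds $q^{c_n}/2^{n+1}$ to the rational value.\<close>

primrec numer :: "nat \<Rightarrow> (nat \<Rightarrow> bool) \<Rightarrow> nat \<Rightarrow> int" where
  "numer q d 0 = 0"
| "numer q d (Suc n) = 2 * numer q d n + of_bool (d n) * int q ^ ones d n"

text \<open>The relation $Y_n = H_{d_n}(Y_{n+1})$ is multiplied by 2 to remain inside the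
  integers.\<close>

definition back_orbit :: "nat \<Rightarrow> (nat \<Rightarrow> bool) \<Rightarrow> (nat \<Rightarrow> int) \<Rightarrow> bool" where
  "back_orbit q d Y \<longleftrightarrow> (\<forall>n. 2 * Y n = (if d n then int q * Y (Suc n) + 1 else Y (Suc n)))"

lemma ones_Suc: "ones d (Suc n) = ones d n + of_bool (d n)"
  by (simp add: ones_def)

lemma ones_mono: "m \<le> n \<Longrightarrow> ones d m \<le> ones d n"
  unfolding ones_def by (rule sum_mono2) auto

lemma ones_unbounded:
  assumes "\<exists>\<^sub>\<infinity>i. d i"
  shows "\<exists>n. m \<le> ones d n"
proof (induction m)
  case (Suc m)
  then obtain n where n: "m \<le> ones d n" by blast
  obtain i where "i \<ge> n" "d i" using assms by (auto simp: INFM_nat_le)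
  then have "Suc m \<le> ones d (Suc i)"
    using n ones_mono[of n i d] by (simp add: ones_Suc)
  then show ?case by blast
qed simp

section \<open>Digits of 2-adic integers\<close>

lemma padic_2_carrier_iff:
  "z \<in> carrier (padic_int_ring 2) \<longleftrightarrow> (\<forall>n. 0 \<le> z n \<and> z n < 2 ^ n \<and> z (Suc n) mod 2 ^ n = z n)"
  by (simp add: padic_int_ring_def)

text \<open>The quotient of \<open>z (Suc n)\<close> by \<open>2 ^ n\<close> is 0 or 1, because
  \<open>z (Suc n) < 2 ^ Suc n\<close>, and the remainder is \<open>z n\<close>.\<close>

lemma padic_2_Suc:
  assumes "z \<in> carrier (padic_int_ring 2)"
  shows "z (Suc n) = z n + of_bool (digit z n) * 2 ^ n"
proof -
  have 1: "z (Suc n) mod 2 ^ n = z n" "0 \<le> z (Suc n)" "z (Suc n) < 2 * 2 ^ n"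
    using assms by (auto simp: padic_2_carrier_iff dest: spec[of _ "Suc n"])
  define e where "e = z (Suc n) div 2 ^ n"
  have 2: "z (Suc n) = e * 2 ^ n + z n" using 1(1) unfolding e_def by (metis div_mult_mod_eq)
  have "0 \<le> z n" using assms by (simp add: padic_2_carrier_iff)
  then have "e * 2 ^ n < 2 * 2 ^ n" using 1(3) 2 by linarith
  then have "e < 2" by simp
  moreover have "0 \<le> e" using 1(2) by (simp add: e_def pos_imp_zdiv_nonneg_iff)
  ultimately have "e = 0 \<or> e = 1" by auto
  then show ?thesis using 2 by (auto simp: digit_def)
qed

lemma padic_2_0: "z \<in> carrier (padic_int_ring 2) \<Longrightarrow> z 0 = 0"
  unfolding padic_2_carrier_iff by (drule spec[of _ 0]) simp

text \<open>Every digit sequence is realized by its partial sums: they stay below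
  \<open>2 ^ n\<close>, so reduction modulo \<open>2 ^ n\<close> removes exactly the term added
  last.\<close>

lemma digit_sum_carrier:
  fixes d :: "nat \<Rightarrow> bool"
  defines "z \<equiv> \<lambda>n. \<Sum>i<n. of_bool (d i) * (2::int) ^ i"
  shows "z \<in> carrier (padic_int_ring 2)" and "digit z = d"
proof -
  have ge: "0 \<le> z n" for n by (simp add: z_def sum_nonneg)
  have step: "z (Suc n) = z n + of_bool (d n) * 2 ^ n" for n
    unfolding z_def by (rule sum.lessThan_Suc)
  have less: "z n < 2 ^ n" for n
  proof (induction n)
    case 0
    show ?case by (simp add: z_def)
  next
    case (Suc n)
    have "z (Suc n) \<le> z n + 2 ^ n" by (simp add: step)
    with Suc show ?case unfolding power_Suc by linarith
  qed
  have "z (Suc n) mod 2 ^ n = z n" for n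
    using ge[of n] less[of n] by (simp add: step)
  then show "z \<in> carrier (padic_int_ring 2)" using ge less by (simp add: padic_2_carrier_iff)
  show "digit z = d" by (simp add: digit_def step fun_eq_iff)
qed

text \<open>Natural numbers are the 2-adic integers with finitely many digits 1: the residues of
  \<open>m\<close> are constant once \<open>2 ^ i\<close> exceeds \<open>m\<close>, and conversely
  residues constant from \<open>N\<close> on are those of the natural number
  \<open>z N\<close>.\<close>

lemma Z2'_iff_digits:
  "z \<in> Z2' \<longleftrightarrow> z \<in> carrier (padic_int_ring 2) \<and> (\<exists>\<^sub>\<infinity>i. digit z i)"
proof (cases "z \<in> carrier (padic_int_ring 2)")
  case z: True
  note bounds = z[unfolded padic_2_carrier_iff, rule_format]
  have "(\<exists>m::nat. z = padic_of_int 2 (int m)) \<longleftrightarrow> (\<exists>N. \<forall>i\<ge>N. \<not> digit z i)"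
  proof
    assume "\<exists>m::nat. z = padic_of_int 2 (int m)"
    then obtain m :: nat where m: "z = padic_of_int 2 (int m)" by blast
    have "z i = int m" if "i \<ge> m" for i
    proof -
      have "m < 2 ^ i" using that less_exp[of i] by linarith
      then have "int m < 2 ^ i" by (metis of_nat_less_iff of_nat_numeral of_nat_power)
      then show ?thesis by (simp add: m padic_of_int_def)
    qed
    then show "\<exists>N. \<forall>i\<ge>N. \<not> digit z i" by (auto simp: digit_def intro!: exI[of _ m])
  next
    assume "\<exists>N. \<forall>i\<ge>N. \<not> digit z i"
    then obtain N where N: "\<And>i. i \<ge> N \<Longrightarrow> z (Suc i) = z i" by (auto simp: digit_def)
    have const: "z i = z N" if "i \<ge> N" for i
      using that by (induction i rule: dec_induct) (auto simp: N)
    have down: "z N mod 2 ^ i = z i" if "i \<le> N" for i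
      using that
    proof (induction i rule: inc_induct)
      case base
      then show ?case using bounds[of N] by simp
    next
      case (step i)
      have "z N mod 2 ^ i = z N mod 2 ^ Suc i mod 2 ^ i" by (rule mod_mod_cancel[symmetric]) simp
      also have "\<dots> = z i" using step bounds[of i] by (simp only: Suc_leI)
      finally show ?case .
    qed
    have "z N mod 2 ^ i = z i" for i
    proof (cases "i \<le> N")
      case False
      then have "z N = z i" using const[of i] by simp
      then show ?thesis using bounds[of i] by (metis mod_pos_pos_trivial)
    qed (rule down)
    then have "z = padic_of_int 2 (int (nat (z N)))"
      using bounds[of N] unfolding padic_of_int_def fun_eq_iff by simp
    then show "\<exists>m::nat. z = padic_of_int 2 (int m)" by blast
  qed
  then show ?thesis using z by (auto simp: Z2'_def INFM_nat_le)
qed (simp add: Z2'_def)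

section \<open>Values of chi_q as congruences modulo powers of q\<close>

lemma H_string_numer:
  "H_string q (map d [0..<n]) 0 = of_int (numer q d n) / 2 ^ n"
proof (induction n)
  case (Suc n)
  have count: "count_list (map d [0..<n]) True = ones d n"
    by (induction n) (auto simp: ones_def)
  \<comment> \<open>The last digit is applied first, and its branch sends 0 to
    \<open>of_bool (d n) / 2\<close>.\<close>
  have "H_string q (map d [0..<Suc n]) 0 = H_string q (map d [0..<n]) (of_bool (d n) / 2)"
    by (simp add: H_string_def H_branch_def)
  also have "\<dots> = of_int (numer q d n) / 2 ^ n + of_nat q ^ ones d n / 2 ^ n * (of_bool (d n) / 2)"
    using H_string_affine[of q "map d [0..<n]" "of_bool (d n) / 2"] Suc count by simp
  finally show ?case by (simp add: field_simps)
qed (simp add: H_string_def)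

lemma chi_nat_digits:
  assumes "z \<in> carrier (padic_int_ring 2)"
  shows "chi_nat q (nat (z n)) = of_int (numer q (digit z) n) / of_int (2 ^ n)"
proof -
  have "int (horner_sum of_bool 2 (map (digit z) [0..<n])) = z n"
    by (induction n) (auto simp: horner_sum_append padic_2_Suc[OF assms] padic_2_0[OF assms])
  then have "nat (z n) = horner_sum of_bool 2 (map (digit z) [0..<n])" by (metis nat_int)
  then show ?thesis using chi_nat_horner_sum H_string_numer by (simp del: of_bool_eq_0_iff)
qed

text \<open>Since \<open>d\<close> is a unit modulo \<open>p ^ m\<close>, the residue of the
  fraction is determined by clearing denominators. The fraction may be reducible, so it is first
  compared with its lowest terms \<open>u / v\<close>.\<close>

lemma padic_of_rat_eq_iff:
  assumes "d \<noteq> 0" "coprime d (int p)" "p > 0"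
  shows "padic_of_rat p (of_int a / of_int d) m = y mod int p ^ m \<longleftrightarrow> [d * y = a] (mod int p ^ m)"
proof -
  define r where "r = (of_int a / of_int d :: rat)"
  obtain u v where uv: "quotient_of r = (u, v)" by fastforce
  have "v > 0" using quotient_of_denom_pos[OF uv] .
  have cop: "coprime v (int p)"
    using coprime_denominator[OF r_def assms(1,2)] uv by simp
  have "of_int u / of_int v = (of_int a / of_int d :: rat)"
    using quotient_of_div[OF uv] r_def by simp
  then have "(of_int (u * d) :: rat) = of_int (a * v)"
    using \<open>v > 0\<close> assms(1) by (simp add: frac_eq_eq)
  then have ud: "u * d = a * v" by (simp only: of_int_eq_iff)
  define t where "t = padic_of_rat p r m"
  have t: "0 \<le> t" "t < int p ^ m" and vt: "[v * t = u] (mod int p ^ m)"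
    using padic_of_rat(1)[of r p] fun_cong[OF padic_of_rat(2)[of r p], of m] uv cop \<open>p > 0\<close>
    by (auto simp: padic_int_ring_def padic_of_int_def cong_def mod_mult_left_eq t_def)
  from vt have "[v * t * d = u * d] (mod int p ^ m)" by (rule cong_scalar_right)
  moreover have "v * t * d = v * (d * t)" "u * d = v * a" using ud by (simp_all add: ac_simps)
  ultimately have "[v * (d * t) = v * a] (mod int p ^ m)" by simp
  then have dt: "[d * t = a] (mod int p ^ m)"
    using cop cong_mult_lcancel[of v "int p ^ m"] by simp
  have "t = y mod int p ^ m \<longleftrightarrow> [t = y] (mod int p ^ m)" using t by (simp add: cong_def)
  also have "\<dots> \<longleftrightarrow> [d * t = d * y] (mod int p ^ m)"
    using assms(2) cong_mult_lcancel[of d "int p ^ m"] by simp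
  also have "\<dots> \<longleftrightarrow> [d * y = a] (mod int p ^ m)" using dt cong_sym cong_trans by blast
  finally show ?thesis by (simp add: t_def r_def)
qed

text \<open>With discrete factors, convergence in the product means that each coordinate is
  eventually constant.\<close>

lemma tendsto_padic_iff:
  fixes s :: "nat \<Rightarrow> nat \<Rightarrow> int"
  shows "s \<longlonglongrightarrow> y \<longleftrightarrow> (\<forall>m. \<forall>\<^sub>F n in sequentially. s n m = y m)"
  using limitin_componentwise[of "\<lambda>_. euclidean" UNIV s y sequentially]
  by (simp add: euclidean_product_topology tendsto_discrete)

lemma chi_eq_padic_of_int_iff:
  assumes q: "odd q" and z: "z \<in> carrier (padic_int_ring 2)"
  shows "chi q z = padic_of_int q x \<longleftrightarrow>
    (\<forall>m. \<forall>\<^sub>F n in sequentially. [2 ^ n * x = numer q (digit z) n] (mod int q ^ m))"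
proof -
  have "q > 0" using q by (cases q) auto
  let ?s = "\<lambda>n. padic_of_rat q (chi_nat q (nat (z n)))"
  have "chi q z = padic_of_int q x \<longleftrightarrow> ?s \<longlonglongrightarrow> padic_of_int q x"
  proof
    assume *: "?s \<longlonglongrightarrow> padic_of_int q x"
    show "chi q z = padic_of_int q x"
    proof
      fix m
      have "\<forall>\<^sub>F n in sequentially. ?s n m = padic_of_int q x m \<and> ?s n m = chi q z m"
        using * chi_limit(2)[OF assms] unfolding tendsto_padic_iff by (intro eventually_conj) auto
      from eventually_happens'[OF sequentially_bot this]
      show "chi q z m = padic_of_int q x m" by auto
    qed
  qed (use chi_limit(2)[OF assms] in simp)
  moreover have "?s n m = padic_of_int q x m \<longleftrightarrow> [2 ^ n * x = numer q (digit z) n] (mod int q ^ m)" for n m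
    unfolding chi_nat_digits[OF z] padic_of_int_def
    by (rule padic_of_rat_eq_iff) (use q \<open>q > 0\<close> in simp_all)
  ultimately show ?thesis unfolding tendsto_padic_iff by simp
qed

section \<open>Backward orbits and values of chi_q\<close>

text \<open>Both branches are merged into one formula that matches the recursions of
  \<open>numer\<close> and \<open>ones\<close>.\<close>

lemma back_orbit_iff:
  "back_orbit q d Y \<longleftrightarrow> (\<forall>n. 2 * Y n = of_bool (d n) + int q ^ of_bool (d n) * Y (Suc n))"
  by (auto simp: back_orbit_def add.commute split: if_splits)

lemma back_orbit_numer:
  assumes "back_orbit q d Y"
  shows "2 ^ n * Y 0 = numer q d n + int q ^ ones d n * Y n"
proof (induction n)
  case (Suc n)
  have "2 ^ Suc n * Y 0 = 2 * numer q d n + int q ^ ones d n * (2 * Y n)"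
    using Suc by (simp add: algebra_simps)
  also have "2 * Y n = of_bool (d n) + int q ^ of_bool (d n) * Y (Suc n)"
    using assms unfolding back_orbit_iff by blast
  finally show ?case by (simp only: ones_Suc power_add numer.simps algebra_simps)
qed (simp add: ones_def)

text \<open>Every term added from step \<open>n\<close> on carries a power of \<open>q\<close> with
  exponent at least \<open>ones d n\<close>, so modulo \<open>int q ^ ones d n\<close> only the
  doublings remain.\<close>

lemma numer_cong:
  assumes "n \<le> n'"
  shows "[numer q d n' = 2 ^ (n' - n) * numer q d n] (mod int q ^ ones d n)"
  using assms
proof (induction n' rule: dec_induct)
  case (step n')
  have "int q ^ ones d n dvd int q ^ ones d n'"
    using ones_mono[OF step(1)] by (rule le_imp_power_dvd)
  then have "[numer q d (Suc n') = 2 * numer q d n'] (mod int q ^ ones d n)"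
    by (auto simp: cong_iff_dvd_diff)
  also have "[2 * numer q d n' = 2 * (2 ^ (n' - n) * numer q d n)] (mod int q ^ ones d n)"
    using step(3) by (rule cong_scalar_left)
  finally show ?case using step(1) by (simp add: Suc_diff_le mult.assoc)
qed simp

text \<open>If \<open>x\<close> is the value, the limit congruence at a late index \<open>k\<close>
  descends to \<open>n\<close> by cancelling \<open>2 ^ (k - n)\<close>, a unit modulo powers of
  \<open>q\<close>; hence $q^{c_n}$ divides $2^n x - A_n$. Conversely, the remainder $q^{c_n} Y_n$
  tends to 0 in the q-adic topology, as $c_n$ is unbounded.\<close>

lemma chi_eq_iff_back_orbit:
  assumes q: "odd q" and z: "z \<in> Z2'"
  shows "chi q z = padic_of_int q x \<longleftrightarrow> (\<exists>Y. back_orbit q (digit z) Y \<and> Y 0 = x)"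
proof -
  define d where "d = digit z"
  have zc: "z \<in> carrier (padic_int_ring 2)" and inf: "\<exists>\<^sub>\<infinity>i. d i"
    using z by (auto simp: Z2'_iff_digits d_def)
  have "q > 0" using q by (cases q) auto
  note chi_iff = chi_eq_padic_of_int_iff[OF q zc, of x, folded d_def]
  show ?thesis unfolding d_def[symmetric]
  proof
    assume "chi q z = padic_of_int q x"
    then have lim: "\<forall>\<^sub>F n in sequentially. [2 ^ n * x = numer q d n] (mod int q ^ m)" for m
      using chi_iff by blast
    have dvd: "int q ^ ones d n dvd 2 ^ n * x - numer q d n" for n
    proof -
      have "\<forall>\<^sub>F k in sequentially. n \<le> k \<and> [2 ^ k * x = numer q d k] (mod int q ^ ones d n)"
        by (intro eventually_conj lim eventually_ge_at_top)
      from eventually_happens'[OF sequentially_bot this]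
      obtain k where k: "n \<le> k" "[2 ^ k * x = numer q d k] (mod int q ^ ones d n)" by blast
      then have "[2 ^ (k - n) * (2 ^ n * x) = 2 ^ (k - n) * numer q d n] (mod int q ^ ones d n)"
        using numer_cong[OF k(1), of q d] cong_trans
        by (simp add: mult.assoc[symmetric] power_add[symmetric])
      moreover have "coprime (2 ^ (k - n)) (int q ^ ones d n)" using q by simp
      ultimately have "[2 ^ n * x = numer q d n] (mod int q ^ ones d n)"
        using cong_mult_lcancel by blast
      then show ?thesis by (simp add: cong_iff_dvd_diff)
    qed
    \<comment> \<open>The division is exact by \<open>dvd\<close>; these quotients are the only
      candidates for a backward orbit of \<open>x\<close>.\<close>
    define Y where "Y n = (2 ^ n * x - numer q d n) div int q ^ ones d n" for n
    have Y: "int q ^ ones d n * Y n = 2 ^ n * x - numer q d n" for n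
      using dvd by (simp add: Y_def)
    have "2 * Y n = of_bool (d n) + int q ^ of_bool (d n) * Y (Suc n)" for n
    proof -
      \<comment> \<open>The recursion is verified after multiplication by $q^{c_n}$, where it
        becomes the recursion of \<open>numer\<close>.\<close>
      have "int q ^ ones d n * (2 * Y n) = 2 * (2 ^ n * x - numer q d n)"
        by (simp only: Y[symmetric] mult.left_commute)
      also have "\<dots> = 2 ^ Suc n * x - numer q d (Suc n) + of_bool (d n) * int q ^ ones d n"
        by simp
      also have "\<dots> = int q ^ ones d n * (of_bool (d n) + int q ^ of_bool (d n) * Y (Suc n))"
        unfolding Y[symmetric] ones_Suc power_add by (simp only: algebra_simps)
      finally show ?thesis using \<open>q > 0\<close> by simp
    qed
    then have "back_orbit q d Y" unfolding back_orbit_iff by blast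
    moreover have "Y 0 = x" by (simp add: Y_def ones_def)
    ultimately show "\<exists>Y. back_orbit q d Y \<and> Y 0 = x" by blast
  next
    assume "\<exists>Y. back_orbit q d Y \<and> Y 0 = x"
    then obtain Y where Y: "back_orbit q d Y" "Y 0 = x" by blast
    show "chi q z = padic_of_int q x"
      unfolding chi_iff
    proof
      fix m
      obtain N where N: "m \<le> ones d N" using ones_unbounded[OF inf] by blast
      have "[2 ^ n * x = numer q d n] (mod int q ^ m)" if "n \<ge> N" for n
      proof -
        have "int q ^ m dvd int q ^ ones d n"
          using ones_mono[OF that, of d] N by (intro le_imp_power_dvd) simp
        then show ?thesis
          using back_orbit_numer[OF Y(1), of n] Y(2) by (simp add: cong_iff_dvd_diff)
      qed
      then show "\<forall>\<^sub>F n in sequentially. [2 ^ n * x = numer q d n] (mod int q ^ m)"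
        by (auto simp: eventually_sequentially)
    qed
  qed
qed

section \<open>Uniqueness of backward orbits and iteration of T_q\<close>

lemma int_eq_if_cong_powers:
  fixes x y :: int
  assumes "1 < p" and "\<And>m. [x = y] (mod int p ^ m)"
  shows "x = y"
proof (rule ccontr)
  assume "x \<noteq> y"
  \<comment> \<open>At this exponent \<open>p ^ m\<close> already exceeds the distance of
    \<open>x\<close> and \<open>y\<close>, which it would have to divide.\<close>
  define m where "m = nat \<bar>x - y\<bar>"
  have "m < p ^ m" using power_gt_expt[of p m] assms(1) by simp
  then have "int m < int p ^ m" by (metis of_nat_less_iff of_nat_power)
  moreover have "int p ^ m dvd x - y" using assms(2) by (simp add: cong_iff_dvd_diff)
  then have "int p ^ m \<le> \<bar>x - y\<bar>" using \<open>x \<noteq> y\<close> dvd_imp_le_int[of "x - y" "int p ^ m"] by simp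
  ultimately show False by (simp add: m_def)
qed

text \<open>The numerators depend on the digits alone and cancel in the difference of two orbits.
  What remains is divisible by $q^{c_n}$ with $c_n$ unbounded, and the factor \<open>2 ^ n\<close>
  is coprime to \<open>q\<close>.\<close>

lemma back_orbit_unique:
  assumes q: "odd q" "1 < q" and inf: "\<exists>\<^sub>\<infinity>i. d i"
    and Y: "back_orbit q d Y" and Y': "back_orbit q d Y'"
  shows "Y 0 = Y' 0"
proof (rule int_eq_if_cong_powers[OF q(2)])
  fix m
  obtain n where n: "m \<le> ones d n" using ones_unbounded[OF inf] by blast
  have "2 ^ n * (Y 0 - Y' 0) = int q ^ ones d n * (Y n - Y' n)"
    using back_orbit_numer[OF Y, of n] back_orbit_numer[OF Y', of n] by (simp add: algebra_simps)
  then have "int q ^ m dvd 2 ^ n * (Y 0 - Y' 0)"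
    using le_imp_power_dvd[OF n, of "int q"] by simp
  moreover have "coprime (int q ^ m) (2 ^ n)" using q by simp
  ultimately show "[Y 0 = Y' 0] (mod int q ^ m)"
    by (simp add: cong_iff_dvd_diff coprime_dvd_mult_right_iff)
qed

lemma back_orbit_T_map:
  assumes "odd q" "back_orbit q d Y"
  shows "T_map q (Y (Suc n)) = Y n"
proof -
  have *: "2 * Y n = (if d n then int q * Y (Suc n) + 1 else Y (Suc n))"
    using assms(2) by (simp add: back_orbit_def)
  show ?thesis
  proof (cases "d n")
    case True
    then have "int q * Y (Suc n) + 1 = 2 * Y n" using * by simp
    moreover from this have "even (int q * Y (Suc n) + 1)" by simp
    then have "odd (Y (Suc n))" using assms(1) by simp
    ultimately show ?thesis by (simp add: T_map_def)
  next
    case False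
    then have "Y (Suc n) = 2 * Y n" using * by simp
    then show ?thesis by (simp add: T_map_def)
  qed
qed

lemma back_orbit_T_map_funpow:
  assumes "odd q" "back_orbit q d Y"
  shows "(T_map q ^^ k) (Y (n + k)) = Y n"
  by (induction k) (simp_all add: back_orbit_T_map[OF assms] funpow_Suc_right del: funpow.simps(2))

text \<open>This keeps 0 out of the image. From $Y_n = 0$, digit 1 would require $q Y_{n+1} = -1$,
  impossible for \<open>q > 1\<close>; so all digits would be 0.\<close>

lemma back_orbit_nonzero:
  assumes "1 < q" "\<exists>\<^sub>\<infinity>i. d i" "back_orbit q d Y"
  shows "Y 0 \<noteq> 0"
proof
  assume 0: "Y 0 = 0"
  have step: "\<not> d n \<and> Y (Suc n) = 0" if "Y n = 0" for n
  proof -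
    have "int q * Y (Suc n) + 1 \<noteq> 0"
    proof
      assume "int q * Y (Suc n) + 1 = 0"
      then have "1 = int q * - Y (Suc n)" by simp
      then have "int q dvd 1" by (rule dvdI)
      then show False using assms(1) by simp
    qed
    then show ?thesis
      using spec[OF assms(3)[unfolded back_orbit_def], of n] that by (cases "d n") simp_all
  qed
  have "Y n = 0" for n by (induction n) (use 0 step in auto)
  then have "\<not> d n" for n using step by blast
  then show False using assms(2) by simp
qed

section \<open>Rational 2-adic integers and periodic digits\<close>

text \<open>Descent on the size of the denominator: if it is even, the congruence modulo 2 makes the
  numerator even, and both can be halved.\<close>

lemma padic_rationals_odd_denominator:
  assumes "z \<in> padic_rationals 2"
  shows "\<exists>a b. odd b \<and> (\<forall>n. [b * z n = a] (mod 2 ^ n))"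
proof -
  have z: "z \<in> carrier (padic_int_ring 2)" using assms by (simp add: padic_rationals_def)
  obtain a0 b0 where "b0 \<noteq> 0"
    and eq: "padic_of_int 2 b0 \<otimes>\<^bsub>padic_int_ring 2\<^esub> z = padic_of_int 2 a0"
    using assms unfolding padic_rationals_def by blast
  have ab0: "[b0 * z n = a0] (mod 2 ^ n)" for n
    using fun_cong[OF eq, of n]
    by (simp add: padic_int_ring_def padic_of_int_def cong_def mod_mult_left_eq)
  have "\<exists>a b. odd b \<and> (\<forall>n. [b * z n = a] (mod 2 ^ n))"
    if "b \<noteq> 0" "\<And>n. [b * z n = a] (mod 2 ^ n)" for a b
    using that
  proof (induction "nat \<bar>b\<bar>" arbitrary: a b rule: less_induct)
    case less
    show ?case
    proof (cases "odd b")
      case False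
      then obtain b' where b': "b = 2 * b'" by blast
      have "even a" using cong_dvd_iff[OF less.prems(2)[of 1]] b' by simp
      then obtain a' where a': "a = 2 * a'" by blast
      \<comment> \<open>Halving costs one power of 2, so the hypothesis is used at
        \<open>Suc n\<close>.\<close>
      have "[b' * z n = a'] (mod 2 ^ n)" for n
      proof -
        have "[2 * (b' * z (Suc n)) = 2 * a'] (mod 2 * 2 ^ n)"
          using less.prems(2)[of "Suc n"] by (simp add: a' b' mult.assoc)
        then have "2 * 2 ^ n dvd 2 * (b' * z (Suc n) - a')"
          by (simp only: cong_iff_dvd_diff right_diff_distrib)
        then have "2 ^ n dvd b' * z (Suc n) - a'" by (subst (asm) dvd_mult_cancel_left) simp
        then have "[b' * z (Suc n) = a'] (mod 2 ^ n)" by (simp only: cong_iff_dvd_diff)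
        moreover have "[z (Suc n) mod 2 ^ n = z (Suc n)] (mod 2 ^ n)" by (simp add: cong_def)
        then have "[z n = z (Suc n)] (mod 2 ^ n)" using z by (simp only: padic_2_carrier_iff)
        then have "[b' * z n = b' * z (Suc n)] (mod 2 ^ n)" by (rule cong_scalar_left)
        ultimately show ?thesis by (metis cong_trans)
      qed
      moreover have "nat \<bar>b'\<bar> < nat \<bar>b\<bar>" "b' \<noteq> 0" using less.prems(1) b' by auto
      ultimately show ?thesis by (intro less.hyps[of b' a'])
    next
      case True
      then show ?thesis using less.prems(2) by (intro exI conjI allI)
    qed
  qed
  from this[OF \<open>b0 \<noteq> 0\<close> ab0] show ?thesis .
qed

text \<open>The numerators of the successive tails of \<open>z = a / b\<close> are bounded, and for odd \<open>b\<close> each of them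
  determines the next digit and the next numerator.\<close>

lemma padic_rationals_eventually_periodic:
  assumes "z \<in> padic_rationals 2"
  obtains l k where "k \<ge> 1" and "\<And>i. digit z (l + k + i) = digit z (l + i)"
proof -
  have z: "z \<in> carrier (padic_int_ring 2)" using assms by (simp add: padic_rationals_def)
  obtain a b where b: "odd b" and ab: "\<And>n. [b * z n = a] (mod 2 ^ n)"
    using padic_rationals_odd_denominator[OF assms] by blast
  \<comment> \<open>The tail $(z - z_n)/2^n$ of \<open>z = a / b\<close> equals
    \<open>A n / b\<close>.\<close>
  define A where "A n = (a - b * z n) div 2 ^ n" for n
  have A: "2 ^ n * A n = a - b * z n" for n
  proof -
    have "2 ^ n dvd a - b * z n" using cong_sym[OF ab[of n]] by (simp only: cong_iff_dvd_diff)
    then show ?thesis by (simp add: A_def)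
  qed
  have step: "2 * A (Suc n) = A n - b * of_bool (digit z n)" for n
  proof -
    have "2 ^ n * (2 * A (Suc n)) = a - b * z (Suc n)"
      unfolding A[symmetric] by simp
    also have "\<dots> = 2 ^ n * (A n - b * of_bool (digit z n))"
      unfolding padic_2_Suc[OF z] right_diff_distrib A by (simp add: algebra_simps)
    finally show ?thesis by simp
  qed
  have dig: "digit z n = odd (A n)" for n
  proof -
    have "A n = 2 * A (Suc n) + b * of_bool (digit z n)" using step[of n] by simp
    then show ?thesis using b by simp
  qed
  have bound: "\<bar>A n\<bar> \<le> \<bar>a\<bar> + \<bar>b\<bar>" for n
  proof -
    have zn: "0 \<le> z n" "z n \<le> 2 ^ n" using z by (simp_all add: padic_2_carrier_iff order_less_imp_le)
    have "2 ^ n * \<bar>A n\<bar> = \<bar>a - b * z n\<bar>" unfolding A[symmetric] by (simp add: abs_mult)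
    also have "\<dots> \<le> \<bar>a\<bar> + \<bar>b\<bar> * z n" using abs_triangle_ineq4[of a "b * z n"] zn by (simp add: abs_mult)
    also have "\<dots> \<le> 2 ^ n * \<bar>a\<bar> + \<bar>b\<bar> * 2 ^ n"
      using zn by (intro add_mono mult_left_mono) (simp_all add: mult_le_cancel_right1)
    also have "\<dots> = 2 ^ n * (\<bar>a\<bar> + \<bar>b\<bar>)" by (simp add: algebra_simps)
    finally show ?thesis by simp
  qed
  have "range A \<subseteq> {- (\<bar>a\<bar> + \<bar>b\<bar>)..\<bar>a\<bar> + \<bar>b\<bar>}"
  proof (rule image_subsetI)
    fix n
    show "A n \<in> {- (\<bar>a\<bar> + \<bar>b\<bar>)..\<bar>a\<bar> + \<bar>b\<bar>}" using bound[of n] by (simp only: atLeastAtMost_iff) linarith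
  qed
  then have "finite (range A)" by (rule finite_subset) simp
  then have "\<not> inj A" using finite_imageD infinite_UNIV_nat by blast
  then obtain i j where ij: "A i = A j" "i \<noteq> j" unfolding inj_def by blast
  obtain l l' where "A l = A l'" "l < l'"
  proof (cases i j rule: linorder_cases)
    case less
    then show ?thesis using that ij by simp
  next
    case greater
    then show ?thesis using that[of j i] ij by simp
  qed (use ij in simp)
  define k where "k = l' - l"
  have k: "k \<ge> 1" "A (l + k + 0) = A (l + 0)" using \<open>l < l'\<close> \<open>A l = A l'\<close> by (auto simp: k_def)
  have "A (l + k + i) = A (l + i)" for i
  proof (induction i)
    case (Suc i)
    have "2 * A (Suc (l + k + i)) = 2 * A (Suc (l + i))" unfolding step dig Suc ..
    then show ?case by simp
  qed (rule k(2))
  then show ?thesis using that[of k l] k(1) dig by simp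
qed

text \<open>A repeating block of length \<open>k\<close> gives $z = z_k + 2^k z$, hence $(1 - 2^k) z
  = z_k$.\<close>

lemma periodic_digits_padic_rationals:
  assumes z: "z \<in> carrier (padic_int_ring 2)" and "k \<ge> 1" and per: "\<And>i. digit z (k + i) = digit z i"
  shows "z \<in> padic_rationals 2"
proof -
  have per': "digit z (i + k) = digit z i" for i using per[of i] by (simp add: add.commute)
  have split: "z (k + n) = z k + 2 ^ k * z n" for n
    by (induction n) (simp_all add: padic_2_0[OF z] padic_2_Suc[OF z] per' power_add algebra_simps)
  have "z (k + n) mod 2 ^ n = z n" for n
  proof (induction k)
    case 0
    then show ?case using z by (simp add: padic_2_carrier_iff)
  next
    case (Suc k)
    have "2 ^ n dvd (2 ^ (k + n) :: int)" by (simp add: le_imp_power_dvd)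
    then show ?case using Suc by (simp add: padic_2_Suc[OF z] mod_add_right_eq[symmetric] del: mod_add_right_eq)
  qed
  then have "[z k + 2 ^ k * z n = z n] (mod 2 ^ n)" for n
    unfolding split[symmetric] cong_def by (metis mod_mod_trivial)
  from cong_sym[OF this] have "2 ^ n dvd z n - (z k + 2 ^ k * z n)" for n
    by (simp only: cong_iff_dvd_diff)
  then have "[(1 - 2 ^ k) * z n = z k] (mod 2 ^ n)" for n
    unfolding cong_iff_dvd_diff by (simp add: algebra_simps)
  then have "padic_of_int 2 (1 - 2 ^ k) \<otimes>\<^bsub>padic_int_ring 2\<^esub> z = padic_of_int 2 (z k)"
    by (simp add: padic_int_ring_def padic_of_int_def fun_eq_iff cong_def mod_mult_left_eq)
  moreover have "(1 - 2 ^ k :: int) \<noteq> 0" using \<open>k \<ge> 1\<close> by simp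
  ultimately show ?thesis using z unfolding padic_rationals_def by blast
qed

section \<open>Periodic points as values of chi_q\<close>

lemma periodic_point_imp_chi:
  assumes q: "odd q" and x: "x \<noteq> 0" "periodic_point q x"
  shows "\<exists>z \<in> padic_rationals 2 \<inter> Z2'. chi q z = padic_of_int q x"
proof -
  obtain k where k: "k \<ge> 1" "(T_map q ^^ k) x = x" using x(2) by (auto simp: periodic_point_def)
  \<comment> \<open>On a cycle of length \<open>k\<close>, the iterate $T_q^{k-1}$ inverts $T_q$, so
    its powers run through the cycle backwards. The truncated subtraction is exact because
    \<open>k \<ge> 1\<close>.\<close>
  define Y where "Y n = (T_map q ^^ ((k - 1) * n)) x" for n
  define d where "d n = odd (Y (Suc n))" for n
  have T_Y: "T_map q (Y (Suc n)) = Y n" for n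
  proof -
    have "Suc ((k - 1) * Suc n) = (k - 1) * n + k" using k(1) by (cases k) simp_all
    then have "T_map q (Y (Suc n)) = (T_map q ^^ ((k - 1) * n + k)) x"
      unfolding Y_def by (metis comp_apply funpow.simps(2))
    then show ?thesis using k(2) by (simp add: funpow_add Y_def)
  qed
  have orbit: "back_orbit q d Y"
    unfolding back_orbit_def
  proof
    fix n
    have "2 * ((int q * Y (Suc n) + 1) div 2) = int q * Y (Suc n) + 1" if "odd (Y (Suc n))"
      using q that by (intro dvd_mult_div_cancel) simp
    then show "2 * Y n = (if d n then int q * Y (Suc n) + 1 else Y (Suc n))"
      unfolding T_Y[of n, symmetric] d_def T_map_def by simp
  qed
  have per: "Y (k + n) = Y n" for n
  proof -
    have "(T_map q ^^ (k * m)) x = x" for m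
      by (induction m) (simp_all add: funpow_add k(2))
    moreover have "(k - 1) * (k + n) = (k - 1) * n + k * (k - 1)"
      by (simp only: distrib_left mult.commute[of k] add.commute)
    ultimately show ?thesis by (simp only: Y_def funpow_add comp_apply)
  qed
  \<comment> \<open>Since $T_q(0) = 0$, a zero at \<open>Suc n\<close> would force one at
    \<open>n\<close>.\<close>
  have Y_nz: "Y n \<noteq> 0" for n
  proof (induction n)
    case (Suc n)
    then show ?case using T_Y[of n] by (auto simp: T_map_def)
  qed (simp add: Y_def x(1))
  have inf: "\<exists>\<^sub>\<infinity>i. d i"
  proof (rule ccontr)
    assume "\<not> ?thesis"
    then obtain N where N: "\<And>i. i \<ge> N \<Longrightarrow> \<not> d i" by (auto simp: INFM_nat_le)
    \<comment> \<open>With digits 0 the backward orbit doubles at each step, which contradicts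
      periodicity of a nonzero orbit.\<close>
    have "Y (N + i) = 2 ^ i * Y N" for i
    proof (induction i)
      case (Suc i)
      then show ?case using orbit N[of "N + i"] by (auto simp: back_orbit_def dest!: spec[of _ "N + i"])
    qed simp
    then have "2 ^ k * Y N = Y N" using per[of N] by (metis add.commute)
    then show False using Y_nz[of N] k(1) by simp
  qed
  define z where "z n = (\<Sum>i<n. of_bool (d i) * (2::int) ^ i)" for n
  have z: "z \<in> carrier (padic_int_ring 2)" "digit z = d"
    using digit_sum_carrier[of d] unfolding z_def by auto
  have "z \<in> Z2'" using z inf by (simp add: Z2'_iff_digits)
  moreover have "z \<in> padic_rationals 2"
    by (rule periodic_digits_padic_rationals[OF z(1) k(1)]) (metis z(2) d_def per add_Suc_right)
  moreover have "chi q z = padic_of_int q x"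
    using chi_eq_iff_back_orbit[OF q \<open>z \<in> Z2'\<close>] orbit z(2) by (auto simp: Y_def intro!: exI[of _ Y])
  ultimately show ?thesis by blast
qed

text \<open>Once the digits repeat, the tails of \<open>Y\<close> from \<open>l\<close> and from
  \<open>l + k\<close> are backward orbits for the same digits, so uniqueness makes their first
  terms equal.\<close>

lemma chi_imp_periodic_point:
  assumes q: "odd q" "1 < q" and z: "z \<in> padic_rationals 2" "z \<in> Z2'"
    and chi: "chi q z = padic_of_int q x"
  shows "x \<noteq> 0" and "periodic_point q x"
proof -
  define d where "d = digit z"
  obtain Y where Y: "back_orbit q d Y" "Y 0 = x"
    using chi chi_eq_iff_back_orbit[OF q(1) z(2)] by (auto simp: d_def)
  have inf: "\<exists>\<^sub>\<infinity>i. d i" using z(2) by (simp add: Z2'_iff_digits d_def)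
  show "x \<noteq> 0" using back_orbit_nonzero[OF q(2) inf Y(1)] Y(2) by simp
  obtain l k where k: "k \<ge> 1" and per: "\<And>i. d (l + k + i) = d (l + i)"
    using padic_rationals_eventually_periodic[OF z(1)] unfolding d_def by blast
  have tails: "back_orbit q (\<lambda>i. d (l + i)) (\<lambda>i. Y (l + i))"
    "back_orbit q (\<lambda>i. d (l + i)) (\<lambda>i. Y (l + k + i))"
    using Y(1) per by (auto simp: back_orbit_def)
  have "\<exists>\<^sub>\<infinity>i. d (l + i)"
    unfolding INFM_nat_le
  proof
    fix m
    obtain n where "n \<ge> l + m" "d n" using inf unfolding INFM_nat_le by blast
    then show "\<exists>n\<ge>m. d (l + n)" by (intro exI[of _ "n - l"]) auto
  qed
  then have eq: "Y l = Y (l + k)" using back_orbit_unique[OF q _ tails] by simp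
  note T = back_orbit_T_map_funpow[OF q(1) Y(1)]
  have "(T_map q ^^ k) x = (T_map q ^^ k) ((T_map q ^^ l) (Y l))"
    using T[of l 0] Y(2) by simp
  \<comment> \<open>The iterates commute, and \<open>Y l\<close> is rewritten as
    \<open>Y (l + k)\<close>, which \<open>k\<close> steps of $T_q$ bring back to
    \<open>Y l\<close>.\<close>
  also have "\<dots> = (T_map q ^^ l) ((T_map q ^^ k) (Y (l + k)))"
    using eq by (metis add.commute comp_apply funpow_add)
  also have "\<dots> = x" using T[of k l] T[of l 0] Y(2) by simp
  finally show "periodic_point q x" using k by (auto simp: periodic_point_def)
qed

theorem corollary2:
  fixes q :: nat
  assumes "prime q" and "odd q"
  shows "padic_of_int q ` {x. x \<noteq> 0 \<and> periodic_point q x}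
           = range (padic_of_int q) \<inter> chi q ` (padic_rationals 2 \<inter> Z2')
       \<and> (\<forall>x. x \<noteq> 0 \<longrightarrow>
           (periodic_point q x \<longleftrightarrow> (\<exists>z \<in> padic_rationals 2 \<inter> Z2'. chi q z = padic_of_int q x)))
       \<and> padic_of_int q 0 \<notin> chi q ` (padic_rationals 2 \<inter> Z2')"
proof -
  have "1 < q" using assms(1) by (rule prime_gt_1_nat)
  note chi = chi_imp_periodic_point[OF \<open>odd q\<close> this]
  have iff: "(\<exists>z \<in> padic_rationals 2 \<inter> Z2'. chi q z = padic_of_int q x)
      \<longleftrightarrow> x \<noteq> 0 \<and> periodic_point q x" for x
    using chi periodic_point_imp_chi[OF \<open>odd q\<close>] by blast
  \<comment> \<open>All three claims are read off from this equivalence for single integers, the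
    last one at \<open>x = 0\<close>.\<close>
  have "padic_of_int q x \<in> chi q ` (padic_rationals 2 \<inter> Z2')
      \<longleftrightarrow> x \<noteq> 0 \<and> periodic_point q x" for x
    unfolding iff[symmetric] by (metis (no_types, lifting) image_iff)
  then show ?thesis using iff by blast
qed

end
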